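(* Let $\eta=(\eta_1,\dots,\eta_p)$ be a composition of $n$ with positive parts and $p\ge3$. Define $l=(l_1,\dots,l_{r_{p-2}})$ by $l_i=\sum_{j=k+1}^{p-1}\eta_j$ whenever $r_{k-1}<i\le r_k$, $1\le k\le p-2$, and let $\widehat\eta=(\eta_1,\dots,\eta_{p-2})$. If $\gamma\in Y_\eta^+$, then $$K_{\Phi(\eta)}(\gamma)=\sum_{\beta}K_{\Phi(\widehat\eta)}(\beta_1-l_1,\dots,\beta_{r_{p-2}}-l_{r_{p-2}})\prod_{j=1}^{r_{p-2}}\binom{\gamma_j+l_j}{\beta_j},$$ where the sum runs over $\beta\in\mathbb{Z}_{\ge0}^{r_{p-2}}$ with $|\beta|=|l|=\sum_{1\le i<j\le p-1}\eta_i\eta_j$.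
   Context: $r_k=\eta_1+\cdots+\eta_k$, $r_0=0$. For a composition $\theta=(\theta_1,\dots,\theta_s)$ of $m$ with positive parts, $\Phi(\theta)=\{(i,j):1\le i\le \theta_1+\cdots+\theta_k<j\le m\text{ for some }k\}$, and for $\gamma\in\mathbb{Z}^m$, $K_{\Phi(\theta)}(\gamma)$ is the number of families $(m_{ij})_{(i,j)\in\Phi(\theta)}$ of non-negative integers with $\sum_j m_{ij}-\sum_j m_{ji}=\gamma_i$ for all $i$ (so it is $0$ unless $\sum\gamma_i=0$). $Y_\eta$ is the set of $\gamma\in\mathbb{Z}^n$ with $\sum\gamma_i=0$ such that for each $0\le k\le p-1$ and every $\Omega\subseteq\{r_k+1,\dots,r_{k+1}\}$, $\sum_{j\le r_k}\gamma_j+\sum_{a\in\Omega}\gamma_a\ge0$. $Y_\eta^+$ is the set of $\gamma\in Y_\eta$ with $\gamma_1\ge\gamma_2\ge\cdots\ge\gamma_{n-1}\ge0$. *)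

theory Defs
  imports Main "HOL-Library.FuncSet"
begin

(* Compositions are lists of naturals.  Vectors indexed by {1..m} are functions on nat of which
   only the values on {1..m} matter; everything below is insensitive to the other values. *)

definition is_composition :: "nat list \<Rightarrow> nat \<Rightarrow> bool" where
  "is_composition \<theta> m \<longleftrightarrow> (\<forall>x\<in>set \<theta>. 0 < x) \<and> sum_list \<theta> = m"

(* Lists count from 0, parts of a composition from 1. *)
definition part :: "nat list \<Rightarrow> nat \<Rightarrow> nat" where
  "part \<theta> i = \<theta> ! (i - 1)"

definition psum :: "nat list \<Rightarrow> nat \<Rightarrow> nat" where
  "psum \<theta> k = (\<Sum>i = 1..k. part \<theta> i)"

definition Phi :: "nat list \<Rightarrow> (nat \<times> nat) set" where
  "Phi \<theta> = {(i, j). \<exists>k\<in>{1..length \<theta>}. 1 \<le> i \<and> i \<le> psum \<theta> k \<and> psum \<theta> k < j \<and> j \<le> sum_list \<theta>}"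

(* Families indexed by Phi are extensional functions (undefined off Phi), so that each family is
   counted once.  The set is finite: all i < j in Phi, so the values are bounded successively. *)
definition kostant :: "nat list \<Rightarrow> (nat \<Rightarrow> int) \<Rightarrow> nat" where
  "kostant \<theta> \<gamma> = card {f \<in> Phi \<theta> \<rightarrow>\<^sub>E (UNIV :: nat set).
     \<forall>i\<in>{1..sum_list \<theta>}.
       (\<Sum>j | (i, j) \<in> Phi \<theta>. int (f (i, j))) - (\<Sum>j | (j, i) \<in> Phi \<theta>. int (f (j, i))) = \<gamma> i}"

definition Y :: "nat list \<Rightarrow> (nat \<Rightarrow> int) set" where
  "Y \<eta> = {\<gamma>. (\<Sum>i = 1..sum_list \<eta>. \<gamma> i) = 0 \<and>
     (\<forall>k<length \<eta>. \<forall>\<Omega>\<subseteq>{psum \<eta> k + 1..psum \<eta> (k + 1)}.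
        0 \<le> (\<Sum>j = 1..psum \<eta> k. \<gamma> j) + (\<Sum>a\<in>\<Omega>. \<gamma> a))}"

definition Y_plus :: "nat list \<Rightarrow> (nat \<Rightarrow> int) set" where
  "Y_plus \<eta> = {\<gamma> \<in> Y \<eta>.
     (\<forall>i j. 1 \<le> i \<and> i \<le> j \<and> j \<le> sum_list \<eta> - 1 \<longrightarrow> \<gamma> j \<le> \<gamma> i) \<and>
     (\<forall>i. 1 \<le> i \<and> i \<le> sum_list \<eta> - 1 \<longrightarrow> 0 \<le> \<gamma> i)}"

end

theory Submission
  imports Defs
begin

text \<open>Because \<open>\<gamma>\<close> lies in \<open>Y_plus \<eta>\<close>, it vanishes on the last block except at the vertex \<open>n\<close>, so the edges into
  \<open>n\<close> are slack variables and the other edges into the last block carry no flow. Hence \<open>kostant \<eta> \<gamma>\<close>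
  counts the families on the first \<open>p - 1\<close> blocks whose outflow at each vertex \<open>i\<close> is at most
  \<open>\<gamma> i\<close> plus the inflow. A Lidskii-type identity, valid for every finite acyclic graph and every non-negative
  supply, rewrites this number as a sum over families \<open>g\<close> of products of binomial coefficients
  with upper index \<open>\<gamma> i + d i\<close> (\<open>d i\<close> the out-degree) and lower index \<open>d i\<close> plus the net outflow of \<open>g\<close>.
  In block \<open>p - 1\<close> all out-degrees vanish, which forces \<open>g\<close> to be zero on the edges into that block;
  grouping the remaining families by \<open>\<beta> = l + net outflow\<close> gives the formula.\<close>

section \<open>Binomial sums\<close>

text \<open>Both sides count the subsets of size \<open>h + k + 1\<close> of a set with
  \<open>n + 1\<close> elements, the left side by the position \<open>t\<close> of the member that
  has \<open>h\<close> members below it. Pascal's rule on the second factor lowers \<open>k\<close>,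
  so the induction keeps \<open>k\<close> arbitrary.\<close>

lemma sum_choose_mult_choose_diff:
  "(\<Sum>t\<le>n. (t choose h) * ((n - t) choose k)) = Suc n choose (h + k + 1)"
proof (induction n arbitrary: k)
  case 0
  then show ?case by (cases h; cases k) auto
next
  case (Suc n)
  show ?case
  proof (cases k)
    case 0
    then show ?thesis using sum_choose_upper[of h "Suc n"] by (simp add: atMost_atLeast0)
  next
    case (Suc k')
    have "(\<Sum>t\<le>Suc n. (t choose h) * ((Suc n - t) choose k))
        = (\<Sum>t\<le>n. (t choose h) * ((n - t) choose k') + (t choose h) * ((n - t) choose k))"
      by (simp add: Suc Suc_diff_le algebra_simps)
    then show ?thesis
      by (simp add: sum.distrib Suc.IH Suc)
  qed
qed

lemma sum_PiE_insert:
  assumes "x \<notin> S"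
  shows "(\<Sum>f\<in>insert x S \<rightarrow>\<^sub>E T. F f) = (\<Sum>y\<in>T. \<Sum>f\<in>S \<rightarrow>\<^sub>E T. F (f(x := y)))"
proof -
  have "(\<Sum>f\<in>insert x S \<rightarrow>\<^sub>E T. F f) = (\<Sum>(y, f)\<in>T \<times> (S \<rightarrow>\<^sub>E T). F (f(x := y)))"
    unfolding PiE_insert_eq
    by (subst sum.reindex[OF inj_combinator[OF assms, of "\<lambda>_. T"]])
       (simp add: case_prod_beta o_def)
  then show ?thesis by (simp add: sum.cartesian_product)
qed

text \<open>Peeling off one coordinate \<open>y\<close> leaves the budget \<open>a - y\<close>, and
  the convolution of binomials above sums over \<open>y\<close>. This serves to sum out the flow
  \<open>u\<close> that leaves a vertex of supply \<open>a\<close>.\<close>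

lemma sum_prod_choose_bounded:
  assumes "finite D" "a \<le> M"
  shows "(\<Sum>u\<in>D \<rightarrow>\<^sub>E {..M}. of_bool (sum u D \<le> a) * (\<Prod>j\<in>D. u j choose h j))
           = a + card D choose (card D + sum h D)"
  using assms
proof (induction D arbitrary: a)
  case empty
  then show ?case by simp
next
  case (insert x D)
  let ?d = "card D" and ?H = "sum h D"
  have upd: "sum (u(x := y)) D = sum u D" "(\<Prod>j\<in>D. (u(x := y)) j choose h j) = (\<Prod>j\<in>D. u j choose h j)"
    for u :: "'a \<Rightarrow> nat" and y
    using insert.hyps by (auto intro!: sum.cong prod.cong)
  have inner: "(\<Sum>u\<in>D \<rightarrow>\<^sub>E {..M}. of_bool (y + sum u D \<le> a) * ((y choose h x) * (\<Prod>j\<in>D. u j choose h j)))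
      = (if y \<le> a then (y choose h x) * (a - y + ?d choose (?d + ?H)) else 0)" for y
  proof (cases "y \<le> a")
    case True
    have "(\<Sum>u\<in>D \<rightarrow>\<^sub>E {..M}. of_bool (y + sum u D \<le> a) * ((y choose h x) * (\<Prod>j\<in>D. u j choose h j)))
       = (\<Sum>u\<in>D \<rightarrow>\<^sub>E {..M}. (y choose h x) * (of_bool (sum u D \<le> a - y) * (\<Prod>j\<in>D. u j choose h j)))"
      using True by (intro sum.cong) auto
    also have "\<dots> = (y choose h x) * (a - y + ?d choose (?d + ?H))"
      using insert.IH[of "a - y"] insert.prems by (simp add: sum_distrib_left[symmetric])
    finally show ?thesis using True by simp
  qed auto
  have "(\<Sum>u\<in>insert x D \<rightarrow>\<^sub>E {..M}. of_bool (sum u (insert x D) \<le> a) * (\<Prod>j\<in>insert x D. u j choose h j))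
      = (\<Sum>y\<le>M. if y \<le> a then (y choose h x) * (a - y + ?d choose (?d + ?H)) else 0)"
    using insert.hyps by (simp add: sum_PiE_insert upd inner del: fun_upd_apply add: fun_upd_same)
  also have "\<dots> = (\<Sum>y\<le>a. (y choose h x) * (a - y + ?d choose (?d + ?H)))"
    using insert.prems by (intro sum.mono_neutral_cong_right) auto
  \<comment> \<open>The terms with \<open>y > a\<close> vanish, since their upper index
    \<open>a + ?d - y\<close> is less than \<open>?d\<close>. The longer range fits the
    convolution.\<close>
  also have "\<dots> = (\<Sum>y\<le>a + ?d. (y choose h x) * (a + ?d - y choose (?d + ?H)))"
    by (intro sum.mono_neutral_cong_left) (auto intro: binomial_eq_0)
  also have "\<dots> = Suc (a + ?d) choose (h x + (?d + ?H) + 1)"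
    by (rule sum_choose_mult_choose_diff)
  finally show ?case using insert.hyps by (simp add: ac_simps)
qed

text \<open>The lower index \<open>a - b\<close> is meant as an integer, so no truncated subtraction may occur.\<close>

definition choose_diff :: "nat \<Rightarrow> nat \<Rightarrow> nat \<Rightarrow> nat" where
  "choose_diff n a b = (if b \<le> a then n choose (a - b) else 0)"

text \<open>Vandermonde's identity, with a range of \<open>h\<close> that is the same for all
  factors of a product.\<close>

lemma choose_diff_add:
  assumes "u \<le> M"
  shows "choose_diff (u + n) a b = (\<Sum>h\<le>M. (u choose h) * choose_diff n a (b + h))"
proof (cases "b \<le> a")
  case True
  have "choose_diff (u + n) a b = (\<Sum>h\<le>a - b. (u choose h) * (n choose (a - b - h)))"
    using True by (simp add: choose_diff_def vandermonde del: diff_diff_left)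
  \<comment> \<open>Either of \<open>M\<close> and \<open>a - b\<close> may be the larger: terms
    beyond \<open>a - b\<close> vanish in \<open>choose_diff\<close>, terms beyond \<open>M\<close>
    because then \<open>h > u\<close>.\<close>
  also have "\<dots> = (\<Sum>h\<le>max M (a - b). (u choose h) * choose_diff n a (b + h))"
    using True by (intro sum.mono_neutral_cong_left) (auto simp: choose_diff_def)
  also have "\<dots> = (\<Sum>h\<le>M. (u choose h) * choose_diff n a (b + h))"
    using assms by (intro sum.mono_neutral_right) (auto intro: binomial_eq_0)
  finally show ?thesis .
qed (simp add: choose_diff_def)

text \<open>Vandermonde in each factor with index in \<open>D\<close>, then expansion of the product
  of sums over functions \<open>h\<close>. The effect is to move \<open>u\<close> out of
  \<open>choose_diff\<close>.\<close>

lemma prod_choose_diff_add: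
  assumes "finite A" "D \<subseteq> A" "u \<in> D \<rightarrow>\<^sub>E {..M}"
  shows "(\<Prod>i\<in>A. choose_diff ((if i \<in> D then u i else 0) + n i) (a i) (b i))
    = (\<Sum>h\<in>D \<rightarrow>\<^sub>E {..M}. (\<Prod>j\<in>D. u j choose h j) *
         (\<Prod>i\<in>A. choose_diff (n i) (a i) (b i + (if i \<in> D then h i else 0))))"
proof -
  have fin: "finite D" using assms finite_subset by blast
  have split: "(\<Prod>i\<in>A. F i) = (\<Prod>i\<in>D. F i) * (\<Prod>i\<in>A - D. F i)" for F :: "'a \<Rightarrow> nat"
    using prod.subset_diff[OF assms(2,1)] by (simp add: mult.commute)
  have "(\<Prod>i\<in>A. choose_diff ((if i \<in> D then u i else 0) + n i) (a i) (b i))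
      = (\<Prod>i\<in>D. choose_diff (u i + n i) (a i) (b i)) * (\<Prod>i\<in>A - D. choose_diff (n i) (a i) (b i))"
    by (simp add: split)
  also have "(\<Prod>i\<in>D. choose_diff (u i + n i) (a i) (b i))
      = (\<Prod>i\<in>D. \<Sum>h\<le>M. (u i choose h) * choose_diff (n i) (a i) (b i + h))"
    using assms(3) by (intro prod.cong refl choose_diff_add) auto
  also have "\<dots> = (\<Sum>h\<in>D \<rightarrow>\<^sub>E {..M}. \<Prod>i\<in>D. (u i choose h i) * choose_diff (n i) (a i) (b i + h i))"
    using fin by (rule prod_sum_PiE) auto
  finally show ?thesis
    by (simp add: split sum_distrib_right prod.distrib mult.assoc)
qed

section \<open>Flows and the Lidskii-type identity\<close>

definition outflow :: "('a \<times> 'a) set \<Rightarrow> ('a \<times> 'a \<Rightarrow> nat) \<Rightarrow> 'a \<Rightarrow> nat" where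
  "outflow E f i = (\<Sum>j | (i, j) \<in> E. f (i, j))"

definition inflow :: "('a \<times> 'a) set \<Rightarrow> ('a \<times> 'a \<Rightarrow> nat) \<Rightarrow> 'a \<Rightarrow> nat" where
  "inflow E f i = (\<Sum>j | (j, i) \<in> E. f (j, i))"

abbreviation outdeg :: "('a \<times> 'a) set \<Rightarrow> 'a \<Rightarrow> nat" where
  "outdeg E i \<equiv> card {j. (i, j) \<in> E}"

text \<open>A family on \<open>E\<close> amounts to its values \<open>u\<close> on the edges leaving
  \<open>b\<close>, indexed by their heads, and its restriction \<open>g\<close> to the other
  edges.\<close>

lemma sum_PiE_split_source:
  fixes F :: "('a \<times> 'b \<Rightarrow> 'c) \<Rightarrow> nat"
  shows "(\<Sum>g\<in>E \<rightarrow>\<^sub>E T. F g)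
    = (\<Sum>u\<in>{j. (b, j) \<in> E} \<rightarrow>\<^sub>E T. \<Sum>g\<in>{e\<in>E. fst e \<noteq> b} \<rightarrow>\<^sub>E T.
         F (\<lambda>e. if fst e = b then u (snd e) else g e))"
  unfolding sum.cartesian_product
proof (rule sum.reindex_bij_witness[where
        j = "\<lambda>g. (\<lambda>j. g (b, j), restrict g {e\<in>E. fst e \<noteq> b})" and
        i = "\<lambda>(u, g) e. if fst e = b then u (snd e) else g e"], goal_cases)
  case (1 g)
  then show ?case by (fastforce simp: fun_eq_iff PiE_def extensional_def)
next
  case (2 g)
  then show ?case by (auto simp: PiE_def extensional_def)
next
  case (3 p)
  then show ?case by (auto simp: fun_eq_iff PiE_def extensional_def)
next
  case (4 p)
  then show ?case by (fastforce simp: PiE_def extensional_def Pi_def)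
next
  case (5 g)
  then have "(\<lambda>e. if fst e = b then g (b, snd e) else restrict g {e \<in> E. fst e \<noteq> b} e) = g"
    by (fastforce simp: fun_eq_iff PiE_def extensional_def)
  then show ?case by simp
qed

text \<open>Induction on the vertex set, removing the least vertex: fixing the flow \<open>u\<close> out of it turns the
  supplies of its successors into \<open>\<gamma> i + u i\<close>. After the induction hypothesis, Vandermonde's identity
  separates \<open>u\<close> from \<open>\<gamma>\<close>, and summing over \<open>u\<close> gives the binomial coefficient of the least vertex.
  The bound \<open>M\<close> only serves to make both sums finite.\<close>

lemma lidskii_count:
  fixes E :: "('a::linorder \<times> 'a) set"
  assumes "finite V" "E \<subseteq> {(i, j). i \<in> V \<and> j \<in> V \<and> i < j}" "sum \<gamma> V \<le> M"
  shows "(\<Sum>f\<in>E \<rightarrow>\<^sub>E {..M}. \<Prod>i\<in>V. of_bool (outflow E f i \<le> \<gamma> i + inflow E f i))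
    = (\<Sum>g\<in>E \<rightarrow>\<^sub>E {..M}. \<Prod>i\<in>V.
         choose_diff (\<gamma> i + outdeg E i) (outdeg E i + outflow E g i) (inflow E g i))"
  using assms
proof (induction V arbitrary: E \<gamma> rule: finite_linorder_min_induct)
  case empty
  then show ?case by simp
next
  case (insert b A)
  \<comment> \<open>\<open>D\<close> holds the successors of \<open>b\<close>, \<open>E'\<close> is
    the graph left on \<open>A\<close>, \<open>m\<close> glues a flow \<open>u\<close> out of
    \<open>b\<close> to a family on \<open>E'\<close>, and \<open>x u\<close> is the extra supply
    that \<open>u\<close> brings to \<open>A\<close>.\<close>
  define D where "D = {j. (b, j) \<in> E}"
  define E' where "E' = {e\<in>E. fst e \<noteq> b}"
  define m where "m u g e = (if fst e = b then u (snd e) else g e)" for u and g :: "'a \<times> 'a \<Rightarrow> nat" and e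
  define x where "x u i = (if i \<in> D then u i else 0)" for u :: "'a \<Rightarrow> nat" and i
  have DA: "D \<subseteq> A" and bA: "b \<notin> A" and E': "E' \<subseteq> {(i, j). i \<in> A \<and> j \<in> A \<and> i < j}"
    using insert.hyps(2) insert.prems(1) by (fastforce simp: D_def E'_def)+
  have finD: "finite D" using DA insert.hyps(1) finite_subset by blast
  have nb: "(j, b) \<notin> E" for j using insert.hyps(2) insert.prems(1) by fastforce
  have split: "(\<Sum>g\<in>E \<rightarrow>\<^sub>E {..M}. F g) = (\<Sum>u\<in>D \<rightarrow>\<^sub>E {..M}. \<Sum>g\<in>E' \<rightarrow>\<^sub>E {..M}. F (m u g))"
    for F :: "('a \<times> 'a \<Rightarrow> nat) \<Rightarrow> nat"
    unfolding D_def E'_def m_def by (rule sum_PiE_split_source)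
  have outb: "outflow E (m u g) b = sum u D" for u g
    by (simp add: outflow_def m_def D_def)
  have inb: "inflow E (m u g) b = 0" for u g
    using nb by (simp add: inflow_def)
  have outA: "outflow E (m u g) i = outflow E' g i" if "i \<in> A" for u g i
    using that bA by (auto simp: outflow_def m_def E'_def intro!: sum.cong)
  have degA: "outdeg E i = outdeg E' i" if "i \<in> A" for i
    using that bA by (auto simp: E'_def intro!: arg_cong[where f = card])
  have inA: "inflow E (m u g) i = x u i + inflow E' g i" if "i \<in> A" for u g i
  proof -
    have eq: "{j. (j, i) \<in> E} = (if i \<in> D then {b} else {}) \<union> {j. (j, i) \<in> E'}"
      by (auto simp: D_def E'_def)
    have "finite {j. (j, i) \<in> E'}"
      using E' by (intro finite_subset[OF _ insert.hyps(1)]) auto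
    moreover have "b \<notin> {j. (j, i) \<in> E'}" by (simp add: E'_def)
    moreover have "(\<Sum>j | (j, i) \<in> E'. m u g (j, i)) = inflow E' g i"
      by (auto simp: inflow_def m_def E'_def intro!: sum.cong)
    ultimately show ?thesis
      unfolding inflow_def[of E] eq by (auto simp: x_def m_def)
  qed
  let ?C = "\<lambda>h g. \<Prod>i\<in>A. choose_diff (\<gamma> i + outdeg E' i) (outdeg E' i + outflow E' g i) (inflow E' g i + x h i)"
  \<comment> \<open>The supply on \<open>A\<close> becomes \<open>\<gamma> i + x u i\<close>. Its
    total stays within \<open>M\<close> because \<open>b\<close> sends out at most its own
    supply.\<close>
  have IH: "(\<Sum>g\<in>E' \<rightarrow>\<^sub>E {..M}. \<Prod>i\<in>A. of_bool (outflow E' g i \<le> \<gamma> i + (x u i + inflow E' g i)))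
      = (\<Sum>g\<in>E' \<rightarrow>\<^sub>E {..M}. \<Sum>h\<in>D \<rightarrow>\<^sub>E {..M}. (\<Prod>j\<in>D. u j choose h j) * ?C h g)"
    if u: "u \<in> D \<rightarrow>\<^sub>E {..M}" "sum u D \<le> \<gamma> b" for u
  proof -
    have "sum (x u) A = sum u D"
      using DA insert.hyps(1) unfolding x_def
      by (simp add: sum.If_cases Int_absorb1)
    then have "(\<Sum>i\<in>A. \<gamma> i + x u i) \<le> M"
      using u(2) insert.prems(2) bA insert.hyps(1) by (simp add: sum.distrib)
    from insert.IH[OF E' this]
    have "(\<Sum>g\<in>E' \<rightarrow>\<^sub>E {..M}. \<Prod>i\<in>A. of_bool (outflow E' g i \<le> \<gamma> i + x u i + inflow E' g i))
      = (\<Sum>g\<in>E' \<rightarrow>\<^sub>E {..M}. \<Prod>i\<in>A. choose_diff (x u i + (\<gamma> i + outdeg E' i)) (outdeg E' i + outflow E' g i) (inflow E' g i))"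
      by (simp add: ac_simps)
    then show ?thesis
      unfolding x_def by (simp only: prod_choose_diff_add[OF insert.hyps(1) DA u(1)] add.assoc)
  qed
  have "(\<Sum>f\<in>E \<rightarrow>\<^sub>E {..M}. \<Prod>i\<in>insert b A. of_bool (outflow E f i \<le> \<gamma> i + inflow E f i))
    = (\<Sum>u\<in>D \<rightarrow>\<^sub>E {..M}. (of_bool (sum u D \<le> \<gamma> b) :: nat) *
        (\<Sum>g\<in>E' \<rightarrow>\<^sub>E {..M}. \<Prod>i\<in>A. of_bool (outflow E' g i \<le> \<gamma> i + (x u i + inflow E' g i))))"
    using insert.hyps(1) bA by (simp add: split outb inb outA inA sum_distrib_left)
  also have "\<dots> = (\<Sum>u\<in>D \<rightarrow>\<^sub>E {..M}. of_bool (sum u D \<le> \<gamma> b) *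
        (\<Sum>g\<in>E' \<rightarrow>\<^sub>E {..M}. \<Sum>h\<in>D \<rightarrow>\<^sub>E {..M}. (\<Prod>j\<in>D. u j choose h j) * ?C h g))"
    using IH by (intro sum.cong refl) (auto simp del: sum.cong)
  \<comment> \<open>The exchanges of sums isolate, for fixed \<open>h\<close>, a sum over
    \<open>u\<close> alone, which \<open>sum_prod_choose_bounded\<close> evaluates.\<close>
  also have "\<dots> = (\<Sum>u\<in>D \<rightarrow>\<^sub>E {..M}. \<Sum>h\<in>D \<rightarrow>\<^sub>E {..M}.
        of_bool (sum u D \<le> \<gamma> b) * (\<Prod>j\<in>D. u j choose h j) * (\<Sum>g\<in>E' \<rightarrow>\<^sub>E {..M}. ?C h g))"
    by (subst sum.swap) (simp add: sum_distrib_left mult.assoc)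
  also have "\<dots> = (\<Sum>h\<in>D \<rightarrow>\<^sub>E {..M}. (\<Sum>u\<in>D \<rightarrow>\<^sub>E {..M}.
        of_bool (sum u D \<le> \<gamma> b) * (\<Prod>j\<in>D. u j choose h j)) * (\<Sum>g\<in>E' \<rightarrow>\<^sub>E {..M}. ?C h g))"
    by (subst sum.swap) (simp add: sum_distrib_right)
  also have "\<dots> = (\<Sum>h\<in>D \<rightarrow>\<^sub>E {..M}. (\<gamma> b + card D choose (card D + sum h D)) * (\<Sum>g\<in>E' \<rightarrow>\<^sub>E {..M}. ?C h g))"
    using insert.prems(2) insert.hyps(1) bA by (subst sum_prod_choose_bounded[OF finD]) auto
  \<comment> \<open>Now \<open>h\<close> plays the part of the new family on the edges leaving
    \<open>b\<close>: \<open>split\<close> read backwards glues it to \<open>g\<close>. As nothing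
    flows into \<open>b\<close>, its factor is an ordinary binomial coefficient.\<close>
  also have "\<dots> = (\<Sum>g\<in>E \<rightarrow>\<^sub>E {..M}. \<Prod>i\<in>insert b A.
         choose_diff (\<gamma> i + outdeg E i) (outdeg E i + outflow E g i) (inflow E g i))"
    using insert.hyps(1) bA
    by (simp add: split outb inb outA inA degA sum_distrib_left)
       (simp add: D_def[symmetric] choose_diff_def[of _ _ 0] ac_simps)
  finally show ?case .
qed

section \<open>Conservation and bounds for flows\<close>

lemma sum_outflow:
  assumes "finite E" "finite S"
  shows "(\<Sum>i\<in>S. outflow E f i) = (\<Sum>e | e \<in> E \<and> fst e \<in> S. f e)"
proof -
  have "finite {j. (i, j) \<in> E}" for i
    by (rule finite_subset[of _ "snd ` E"]) (use assms in force)+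
  then have "(\<Sum>i\<in>S. outflow E f i) = (\<Sum>(i, j)\<in>Sigma S (\<lambda>i. {j. (i, j) \<in> E}). f (i, j))"
    unfolding outflow_def using assms by (subst sum.Sigma) auto
  also have "\<dots> = (\<Sum>e | e \<in> E \<and> fst e \<in> S. f e)"
    by (rule sum.cong) auto
  finally show ?thesis .
qed

lemma sum_inflow:
  assumes "finite E" "finite S"
  shows "(\<Sum>i\<in>S. inflow E f i) = (\<Sum>e | e \<in> E \<and> snd e \<in> S. f e)"
proof -
  have fin: "finite {j. (j, i) \<in> E}" for i
    by (rule finite_subset[of _ "fst ` E"]) (use assms in force)+
  then have "(\<Sum>i\<in>S. inflow E f i) = (\<Sum>(i, j)\<in>Sigma S (\<lambda>i. {j. (j, i) \<in> E}). f (j, i))"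
    unfolding inflow_def using assms by (subst sum.Sigma) auto
  also have "\<dots> = (\<Sum>e | e \<in> E \<and> snd e \<in> S. f e)"
    by (rule sum.reindex_bij_witness[where i = prod.swap and j = prod.swap]) auto
  finally show ?thesis .
qed

lemma sum_outflow_eq_sum_inflow:
  assumes "finite V" "E \<subseteq> V \<times> V"
  shows "sum (outflow E f) V = sum (inflow E f) V"
proof -
  have fin: "finite E" using assms finite_subset by blast
  have "{e \<in> E. fst e \<in> V} = {e \<in> E. snd e \<in> V}" using assms(2) by auto
  then show ?thesis by (simp add: sum_outflow sum_inflow fin assms(1))
qed

text \<open>Compare the flow across the cut after \<open>u\<close> with the supply of the vertices up to \<open>u\<close>, where
  \<open>e = (u, v)\<close>.\<close>

lemma flow_le_sum_supply:
  fixes E :: "('a::linorder \<times> 'a) set"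
  assumes "finite V" "E \<subseteq> {(i, j). i \<in> V \<and> j \<in> V \<and> i < j}"
    and f: "\<And>i. i \<in> V \<Longrightarrow> outflow E f i \<le> \<gamma> i + inflow E f i" and e: "e \<in> E"
  shows "f e \<le> sum \<gamma> V"
proof -
  obtain u v where [simp]: "e = (u, v)" by (cases e)
  define S where "S = {i\<in>V. i \<le> u}"
  have fin: "finite E" "finite S"
    using assms by (auto simp: S_def intro: finite_subset[of E "V \<times> V"])
  \<comment> \<open>Edges increase, so an edge that ends in \<open>S\<close> also starts there,
    while \<open>e\<close> starts in \<open>S\<close> and ends outside it.\<close>
  have "(\<Sum>e' | e' \<in> E \<and> snd e' \<in> S. f e') + f e = (\<Sum>e'\<in>insert e {e' \<in> E. snd e' \<in> S}. f e')"
    using fin e assms(2) by (subst sum.insert) (auto simp: S_def)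
  also have "\<dots> \<le> (\<Sum>e' | e' \<in> E \<and> fst e' \<in> S. f e')"
    using fin e assms(2) by (intro sum_mono2) (fastforce simp: S_def)+
  also have "\<dots> = (\<Sum>i\<in>S. outflow E f i)"
    using fin by (simp add: sum_outflow)
  also have "\<dots> \<le> (\<Sum>i\<in>S. \<gamma> i + inflow E f i)"
    by (intro sum_mono f) (simp add: S_def)
  also have "\<dots> = sum \<gamma> S + (\<Sum>e' | e' \<in> E \<and> snd e' \<in> S. f e')"
    using fin by (simp add: sum.distrib sum_inflow)
  finally have "f e \<le> sum \<gamma> S" by simp
  also have "\<dots> \<le> sum \<gamma> V"
    using assms(1) by (intro sum_mono2) (auto simp: S_def)
  finally show ?thesis .
qed

section \<open>Joining a block of sinks to a graph\<close>

text \<open>This is how \<open>Phi\<close> grows when a block is appended: every earlier vertex gets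
  an edge to every new one, and the new ones have no successors.\<close>

lemma
  assumes "V \<inter> W = {}" "E \<subseteq> V \<times> V" "finite V" "finite W"
  shows outflow_join: "i \<in> V \<Longrightarrow> outflow (E \<union> V \<times> W) f i = outflow E f i + (\<Sum>j\<in>W. f (i, j))"
    and inflow_join: "i \<in> V \<Longrightarrow> inflow (E \<union> V \<times> W) f i = inflow E f i"
    and outflow_join_sink: "i \<in> W \<Longrightarrow> outflow (E \<union> V \<times> W) f i = 0"
    and inflow_join_sink: "i \<in> W \<Longrightarrow> inflow (E \<union> V \<times> W) f i = (\<Sum>j\<in>V. f (j, i))"
proof -
  show "outflow (E \<union> V \<times> W) f i = outflow E f i + (\<Sum>j\<in>W. f (i, j))" if "i \<in> V"
  proof -
    have "{j. (i, j) \<in> E \<union> V \<times> W} = {j. (i, j) \<in> E} \<union> W" using that by auto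
    moreover have "{j. (i, j) \<in> E} \<inter> W = {}" using assms by auto
    moreover have "finite {j. (i, j) \<in> E}"
      by (rule finite_subset[OF _ assms(3)]) (use assms in auto)
    ultimately show ?thesis using assms(4) by (simp add: outflow_def sum.union_disjoint)
  qed
  show "inflow (E \<union> V \<times> W) f i = inflow E f i" if "i \<in> V"
    using that assms(1,2) by (auto simp: inflow_def intro!: sum.cong)
  have "{j. (i, j) \<in> E \<union> V \<times> W} = {}" "{j. (j, i) \<in> E \<union> V \<times> W} = V" if "i \<in> W"
    using that assms(1,2) by auto
  then show "i \<in> W \<Longrightarrow> outflow (E \<union> V \<times> W) f i = 0"
    "i \<in> W \<Longrightarrow> inflow (E \<union> V \<times> W) f i = (\<Sum>j\<in>V. f (j, i))"
    by (simp_all only: outflow_def inflow_def sum.empty)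
qed

lemma outflow_cong: "(\<And>e. e \<in> E \<Longrightarrow> f e = g e) \<Longrightarrow> outflow E f i = outflow E g i"
  and inflow_cong: "(\<And>e. e \<in> E \<Longrightarrow> f e = g e) \<Longrightarrow> inflow E f i = inflow E g i"
  by (auto simp: outflow_def inflow_def intro: sum.cong)

text \<open>The edges into \<open>s\<close> are slack variables that turn the inequalities on
  \<open>V\<close> into equations, and the sinks other than \<open>s\<close> receive nothing. The
  equation at \<open>s\<close> then follows because the total supply is zero.\<close>

lemma card_flows_join_sinks:
  fixes \<gamma> :: "'a \<Rightarrow> int"
  assumes VW: "V \<inter> W = {}" "E \<subseteq> V \<times> V" "finite V" "finite W"
    and s: "s \<in> W" and \<gamma>0: "\<And>i. i \<in> W - {s} \<Longrightarrow> \<gamma> i = 0" and total: "sum \<gamma> (V \<union> W) = 0"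
  shows "card {F \<in> E \<union> V \<times> W \<rightarrow>\<^sub>E UNIV. \<forall>i\<in>V \<union> W.
            int (outflow (E \<union> V \<times> W) F i) - int (inflow (E \<union> V \<times> W) F i) = \<gamma> i}
       = card {f \<in> E \<rightarrow>\<^sub>E UNIV. \<forall>i\<in>V. int (outflow E f i) \<le> \<gamma> i + int (inflow E f i)}"
    (is "card ?A = card ?B")
proof -
  \<comment> \<open>What is left over at \<open>i\<close> goes to \<open>s\<close>. For
    \<open>f\<close> in \<open>?B\<close> and \<open>i\<close> in \<open>V\<close> it is
    non-negative, so \<open>nat\<close> loses nothing.\<close>
  define slack where "slack f i = nat (\<gamma> i + int (inflow E f i) - int (outflow E f i))" for f i
  define ext where "ext f e = (if e \<in> E then f e else if e \<in> V \<times> W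
      then if snd e = s then slack f (fst e) else 0 else undefined)" for f and e :: "'a \<times> 'a"
  note joins = outflow_join[OF VW] inflow_join[OF VW] outflow_join_sink[OF VW] inflow_join_sink[OF VW]
  have \<gamma>s: "sum \<gamma> V = - \<gamma> s"
  proof -
    have "sum \<gamma> (V \<union> W) = sum \<gamma> V + (\<gamma> s + sum \<gamma> (W - {s}))"
      using VW s by (simp add: sum.union_disjoint sum.remove)
    then show ?thesis using total \<gamma>0 by simp
  qed
  have flow_E: "outflow E (ext f) i = outflow E f i" "inflow E (ext f) i = inflow E f i" for f i
    by (intro outflow_cong inflow_cong; simp add: ext_def)+
  have notE: "(i, j) \<notin> E" if "j \<in> W" for i j using that VW by auto
  have eqs: "(\<forall>i\<in>V \<union> W. int (outflow (E \<union> V \<times> W) F i) - int (inflow (E \<union> V \<times> W) F i) = \<gamma> i)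
    \<longleftrightarrow> (\<forall>i\<in>V. int (outflow E F i) + int (F (i, s)) = \<gamma> i + int (inflow E F i))
        \<and> (\<forall>i\<in>V. \<forall>j\<in>W - {s}. F (i, j) = 0)" (is "?L \<longleftrightarrow> ?R") for F
  proof
    assume L: ?L
    have z: "F (i, j) = 0" if "i \<in> V" "j \<in> W - {s}" for i j
    proof -
      have "int (\<Sum>i\<in>V. F (i, j)) = 0"
        using L[rule_format, of j] that \<gamma>0[of j] by (simp add: joins del: of_nat_sum)
      then have "(\<Sum>i\<in>V. F (i, j)) = 0" by (simp only: of_nat_eq_0_iff)
      then show ?thesis using that VW by simp
    qed
    have "int (outflow E F i) + int (F (i, s)) = \<gamma> i + int (inflow E F i)" if "i \<in> V" for i
    proof -
      have "(\<Sum>j\<in>W. F (i, j)) = F (i, s)"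
        using VW s z that by (simp add: sum.remove)
      then show ?thesis using L[rule_format, of i] that by (simp add: joins)
    qed
    with z show ?R by blast
  next
    assume R: ?R
    have V: "int (outflow (E \<union> V \<times> W) F i) - int (inflow (E \<union> V \<times> W) F i) = \<gamma> i" if "i \<in> V" for i
    proof -
      have "(\<Sum>j\<in>W. F (i, j)) = F (i, s)"
        using VW s R that by (simp add: sum.remove)
      then show ?thesis using R[THEN conjunct1, rule_format, of i] that by (simp add: joins)
    qed
    \<comment> \<open>The balance at \<open>s\<close>: summed over \<open>V\<close>, outflow and
      inflow inside \<open>E\<close> cancel and only the supply of \<open>V\<close> remains.\<close>
    have "(\<Sum>i\<in>V. int (F (i, s))) = (\<Sum>i\<in>V. \<gamma> i + int (inflow E F i) - int (outflow E F i))"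
      using R by (intro sum.cong) auto
    also have "\<dots> = - \<gamma> s + int (sum (inflow E F) V) - int (sum (outflow E F) V)"
      by (simp add: sum.distrib sum_subtractf \<gamma>s)
    also have "\<dots> = - \<gamma> s"
      by (simp only: sum_outflow_eq_sum_inflow[OF VW(3,2)])
    finally have "int (\<Sum>i\<in>V. F (i, s)) = - \<gamma> s" by simp
    moreover have "(\<Sum>i\<in>V. F (i, j)) = 0" if "j \<in> W - {s}" for j
      using R that by (intro sum.neutral) blast
    ultimately have "int (outflow (E \<union> V \<times> W) F i) - int (inflow (E \<union> V \<times> W) F i) = \<gamma> i" if "i \<in> W" for i
      using that \<gamma>0[of i] by (cases "i = s") (simp_all add: joins)
    with V show ?L by blast
  qed
  have "bij_betw (\<lambda>F. restrict F E) ?A ?B"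
  proof (rule bij_betwI[where g = ext])
    show "(\<lambda>F. restrict F E) \<in> ?A \<rightarrow> ?B"
    proof
      fix F assume "F \<in> ?A"
      then have "\<forall>i\<in>V. int (outflow E F i) \<le> \<gamma> i + int (inflow E F i)"
        unfolding mem_Collect_eq eqs by (metis le_add_same_cancel1 of_nat_0_le_iff)
      moreover have "outflow E (restrict F E) i = outflow E F i" "inflow E (restrict F E) i = inflow E F i" for i
        by (intro outflow_cong inflow_cong; simp)+
      ultimately show "restrict F E \<in> ?B" by simp
    qed
    show "ext \<in> ?B \<rightarrow> ?A"
    proof
      fix f assume f: "f \<in> ?B"
      then have "int (slack f i) = \<gamma> i + int (inflow E f i) - int (outflow E f i)" if "i \<in> V" for i
        using that by (simp add: slack_def)
      then show "ext f \<in> ?A"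
        unfolding mem_Collect_eq eqs flow_E using s f notE by (auto simp: ext_def split: if_splits)
    qed
    show "ext (restrict F E) = F" if "F \<in> ?A" for F
    proof
      fix e
      have F: "\<forall>i\<in>V. int (outflow E F i) + int (F (i, s)) = \<gamma> i + int (inflow E F i)"
        "\<forall>i\<in>V. \<forall>j\<in>W - {s}. F (i, j) = 0" "F \<in> E \<union> V \<times> W \<rightarrow>\<^sub>E UNIV"
        using that unfolding mem_Collect_eq eqs by blast+
      have "outflow E (restrict F E) i = outflow E F i" "inflow E (restrict F E) i = inflow E F i" for i
        by (intro outflow_cong inflow_cong; simp)+
      then have "slack (restrict F E) i = F (i, s)" if "i \<in> V" for i
        unfolding slack_def using F(1)[rule_format, OF that] by simp
      then show "ext (restrict F E) e = F e"
        using F(2,3) by (cases e) (auto simp: ext_def PiE_def extensional_def)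
    qed
    show "restrict (ext f) E = f" if "f \<in> ?B" for f
      using that by (auto simp: ext_def fun_eq_iff PiE_def extensional_def)
  qed
  then show ?thesis by (rule bij_betw_same_card)
qed

text \<open>At a sink both \<open>d\<close> and the outflow are zero, so any inflow makes the lower
  index negative and the factor zero; without inflow the factor is 1. In the application
  \<open>d\<close> is the out-degree in the larger graph, on both sides.\<close>

lemma sum_choose_diff_join_sinks:
  fixes \<gamma> d :: "'a \<Rightarrow> nat"
  assumes VW: "V \<inter> W = {}" "E \<subseteq> V \<times> V" "finite V" "finite W"
    and d: "\<And>i. i \<in> W \<Longrightarrow> d i = 0"
  shows "(\<Sum>g\<in>E \<union> V \<times> W \<rightarrow>\<^sub>E {..M}. \<Prod>i\<in>V \<union> W.
            choose_diff (\<gamma> i + d i) (d i + outflow (E \<union> V \<times> W) g i) (inflow (E \<union> V \<times> W) g i))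
       = (\<Sum>g\<in>E \<rightarrow>\<^sub>E {..M}. \<Prod>i\<in>V. choose_diff (\<gamma> i + d i) (d i + outflow E g i) (inflow E g i))"
    (is "(\<Sum>g\<in>?X. ?F g) = (\<Sum>g\<in>?Z. ?G g)")
proof -
  note joins = outflow_join[OF VW] inflow_join[OF VW] outflow_join_sink[OF VW] inflow_join_sink[OF VW]
  have finE: "finite (E \<union> V \<times> W)" using VW finite_subset by blast
  define ext where "ext g e = (if e \<in> E then g e else if e \<in> V \<times> W then 0 else undefined)"
    for g :: "'a \<times> 'a \<Rightarrow> nat" and e
  have notE: "(i, j) \<notin> E" if "j \<in> W" for i j using that VW by auto
  define X0 where "X0 = {g \<in> ?X. \<forall>e\<in>V \<times> W. g e = 0}"
  have F: "?F g = ?G g" if "g \<in> X0" for g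
  proof -
    have "(\<Sum>j\<in>W. g (i, j)) = 0" if "i \<in> V" for i
      using that \<open>g \<in> X0\<close> by (intro sum.neutral) (auto simp: X0_def)
    moreover have "(\<Sum>i\<in>V. g (i, j)) = 0" if "j \<in> W" for j
      using that \<open>g \<in> X0\<close> by (intro sum.neutral) (auto simp: X0_def)
    ultimately show ?thesis
      using VW d by (simp add: prod.union_disjoint joins choose_diff_def[of _ 0 0])
  qed
  have "(\<Sum>g\<in>?X. ?F g) = (\<Sum>g\<in>X0. ?F g)"
  proof (rule sum.mono_neutral_right)
    show "finite ?X" using finE by (intro finite_PiE) auto
    show "\<forall>g\<in>?X - X0. ?F g = 0"
    proof
      fix g assume "g \<in> ?X - X0"
      then obtain i j where ij: "i \<in> V" "j \<in> W" "g (i, j) \<noteq> 0" by (auto simp: X0_def)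
      then have "(\<Sum>i\<in>V. g (i, j)) \<noteq> 0" using VW by auto
      then have "choose_diff (\<gamma> j + d j) (d j + outflow (E \<union> V \<times> W) g j) (inflow (E \<union> V \<times> W) g j) = 0"
        using ij d by (simp add: joins choose_diff_def)
      then show "?F g = 0"
        using ij VW by (intro prod_zero) auto
    qed
  qed (auto simp: X0_def)
  also have "\<dots> = (\<Sum>g\<in>?Z. ?G g)"
  proof (rule sum.reindex_bij_witness[where i = ext and j = "\<lambda>g. restrict g E"], goal_cases)
    case (1 g)
    then show ?case by (auto simp: X0_def ext_def fun_eq_iff PiE_def extensional_def)
  next
    case (2 g)
    then show ?case by (auto simp: X0_def)
  next
    case (3 g)
    then show ?case by (auto simp: X0_def ext_def fun_eq_iff PiE_def extensional_def)
  next
    case (4 g)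
    then show ?case using notE by (auto simp: X0_def ext_def split: if_splits)
  next
    case (5 g)
    have "outflow E (restrict g E) i = outflow E g i" "inflow E (restrict g E) i = inflow E g i" for i
      by (intro outflow_cong inflow_cong; simp)+
    then show ?case using F[OF 5] by simp
  qed
  finally show ?thesis .
qed

section \<open>Grouping families by their net outflow\<close>

text \<open>Each \<open>g\<close> determines \<open>\<beta>\<close> as \<open>l\<close> plus the net
  outflow. The values of \<open>\<beta>\<close> are non-negative exactly if no lower index in
  \<open>choose_diff\<close> is negative, and their sum is that of \<open>l\<close> because net
  outflows cancel.\<close>

lemma sum_card_flows_mult_prod_choose:
  fixes E :: "('a::linorder \<times> 'a) set" and l a :: "'a \<Rightarrow> nat"
  assumes "finite V" "E \<subseteq> {(i, j). i \<in> V \<and> j \<in> V \<and> i < j}" "sum l V \<le> M"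
  shows "(\<Sum>\<beta> | \<beta> \<in> V \<rightarrow>\<^sub>E UNIV \<and> sum \<beta> V = sum l V.
            card {g \<in> E \<rightarrow>\<^sub>E UNIV. \<forall>i\<in>V. int (outflow E g i) - int (inflow E g i) = int (\<beta> i) - int (l i)} *
            (\<Prod>i\<in>V. a i choose \<beta> i))
       = (\<Sum>g\<in>E \<rightarrow>\<^sub>E {..M}. \<Prod>i\<in>V. choose_diff (a i) (l i + outflow E g i) (inflow E g i))"
proof -
  let ?B = "{\<beta> \<in> V \<rightarrow>\<^sub>E UNIV. sum \<beta> V = sum l V}"
  let ?Z = "{g \<in> E \<rightarrow>\<^sub>E {..M}. \<forall>i\<in>V. inflow E g i \<le> l i + outflow E g i}"
  \<comment> \<open>The balance equations without subtraction and with values bounded by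
    \<open>M\<close>; the fact \<open>G\<close> below shows that the bound excludes nothing.\<close>
  define G where "G \<beta> = {g \<in> E \<rightarrow>\<^sub>E {..M}. \<forall>i\<in>V. \<beta> i + inflow E g i = l i + outflow E g i}" for \<beta>
  have EV: "E \<subseteq> V \<times> V" using assms(2) by auto
  then have finE: "finite E" using assms(1) finite_subset by blast
  have finX: "finite (E \<rightarrow>\<^sub>E {..M})" using finE by (intro finite_PiE) auto
  have finG: "finite (G \<beta>)" for \<beta> using finX by (simp add: G_def)
  have finB: "finite ?B"
  proof (rule finite_subset)
    show "?B \<subseteq> V \<rightarrow>\<^sub>E {..sum l V}"
    proof
      fix \<beta> assume \<beta>: "\<beta> \<in> ?B"
      then have "\<beta> i \<le> sum l V" if "i \<in> V" for i
        using member_le_sum[of i V \<beta>] that assms(1) by simp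
      then show "\<beta> \<in> V \<rightarrow>\<^sub>E {..sum l V}" using \<beta> by (auto simp: PiE_def)
    qed
  qed (use assms(1) in \<open>auto intro: finite_PiE\<close>)
  have G: "{g \<in> E \<rightarrow>\<^sub>E UNIV. \<forall>i\<in>V. int (outflow E g i) - int (inflow E g i) = int (\<beta> i) - int (l i)} = G \<beta>"
    if "\<beta> \<in> ?B" for \<beta>
  proof (intro equalityI subsetI)
    fix g assume g: "g \<in> {g \<in> E \<rightarrow>\<^sub>E UNIV. \<forall>i\<in>V. int (outflow E g i) - int (inflow E g i) = int (\<beta> i) - int (l i)}"
    have eq: "\<beta> i + inflow E g i = l i + outflow E g i" if "i \<in> V" for i
    proof -
      have "int (outflow E g i) - int (inflow E g i) = int (\<beta> i) - int (l i)" using g that by blast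
      then show ?thesis by linarith
    qed
    \<comment> \<open>By the balance equation \<open>g\<close> is a flow with supply
      \<open>\<beta>\<close>, whose total is that of \<open>l\<close>.\<close>
    have "g e \<le> sum \<beta> V" if "e \<in> E" for e
      by (rule flow_le_sum_supply[OF assms(1,2) _ that]) (use eq in \<open>force simp: le_iff_add\<close>)
    then have "g e \<le> M" if "e \<in> E" for e
      using that \<open>\<beta> \<in> ?B\<close> assms(3) by fastforce
    then show "g \<in> G \<beta>" using g eq by (auto simp: G_def PiE_def)
  next
    fix g assume g: "g \<in> G \<beta>"
    have "int (outflow E g i) - int (inflow E g i) = int (\<beta> i) - int (l i)" if "i \<in> V" for i
    proof -
      have "\<beta> i + inflow E g i = l i + outflow E g i" using g that by (simp add: G_def)
      then show ?thesis by linarith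
    qed
    then show "g \<in> {g \<in> E \<rightarrow>\<^sub>E UNIV. \<forall>i\<in>V. int (outflow E g i) - int (inflow E g i) = int (\<beta> i) - int (l i)}"
      using g by (auto simp: G_def PiE_def)
  qed
  have "(\<Sum>\<beta>\<in>?B. card {g \<in> E \<rightarrow>\<^sub>E UNIV. \<forall>i\<in>V. int (outflow E g i) - int (inflow E g i) = int (\<beta> i) - int (l i)} *
            (\<Prod>i\<in>V. a i choose \<beta> i)) = (\<Sum>\<beta>\<in>?B. \<Sum>g\<in>G \<beta>. \<Prod>i\<in>V. a i choose \<beta> i)"
    by (rule sum.cong[OF refl]) (simp only: G sum_constant of_nat_id)
  also have "\<dots> = (\<Sum>(\<beta>, g)\<in>Sigma ?B G. \<Prod>i\<in>V. a i choose \<beta> i)"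
    using finB finG by (subst sum.Sigma) auto
  also have "\<dots> = (\<Sum>g\<in>?Z. \<Prod>i\<in>V. choose_diff (a i) (l i + outflow E g i) (inflow E g i))"
  \<comment> \<open>The truncated subtraction in the witness is exact on \<open>?Z\<close>.\<close>
  proof (rule sum.reindex_bij_witness[where j = snd and
        i = "\<lambda>g. (\<lambda>i\<in>V. l i + outflow E g i - inflow E g i, g)"], goal_cases)
    case (1 p)
    then have p: "fst p \<in> V \<rightarrow>\<^sub>E UNIV" "\<And>i. i \<in> V \<Longrightarrow> fst p i + inflow E (snd p) i = l i + outflow E (snd p) i"
      by (auto simp: G_def)
    have "restrict (\<lambda>i. l i + outflow E (snd p) i - inflow E (snd p) i) V i = fst p i" for i
      using p(1) p(2)[of i, symmetric] by (cases "i \<in> V") (simp_all add: PiE_def extensional_def)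
    then show ?case by (cases p) (auto simp: fun_eq_iff)
  next
    case (2 p)
    then show ?case by (auto simp: G_def) (metis le_add2)
  next
    case (3 g)
    then show ?case by simp
  next
    case (4 g)
    have "(\<Sum>i\<in>V. l i + outflow E g i - inflow E g i) + sum (inflow E g) V
        = (\<Sum>i\<in>V. l i + outflow E g i)"
      unfolding sum.distrib[symmetric] by (rule sum.cong) (use 4 in auto)
    then have "(\<Sum>i\<in>V. l i + outflow E g i - inflow E g i) = sum l V"
      using sum_outflow_eq_sum_inflow[OF assms(1) EV, of g] by (simp add: sum.distrib)
    then show ?case using 4 by (auto simp: G_def)
  next
    case (5 p)
    then have "\<And>i. i \<in> V \<Longrightarrow> fst p i + inflow E (snd p) i = l i + outflow E (snd p) i"
      by (auto simp: G_def)
    then have "choose_diff (a i) (l i + outflow E (snd p) i) (inflow E (snd p) i) = a i choose fst p i" if "i \<in> V" for i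
      using that unfolding choose_diff_def by (metis add_diff_cancel_right' le_add2)
    then show ?case by (auto simp: case_prod_beta)
  qed
  also have "\<dots> = (\<Sum>g\<in>E \<rightarrow>\<^sub>E {..M}. \<Prod>i\<in>V. choose_diff (a i) (l i + outflow E g i) (inflow E g i))"
    using finX by (intro sum.mono_neutral_left) (auto simp: choose_diff_def assms(1) intro!: prod_zero)
  finally show ?thesis .
qed

section \<open>Partial sums of a composition and the sets \<open>Phi\<close>\<close>

lemma psum_mono: "k \<le> m \<Longrightarrow> psum \<theta> k \<le> psum \<theta> m"
  unfolding psum_def by (intro sum_mono2) auto

lemma psum_0 [simp]: "psum \<theta> 0 = 0"
  by (simp add: psum_def)

lemma psum_Suc: "psum \<theta> (Suc k) = psum \<theta> k + part \<theta> (Suc k)"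
  by (simp add: psum_def)

lemma psum_take: "k \<le> m \<Longrightarrow> psum (take m \<theta>) k = psum \<theta> k"
  unfolding psum_def part_def by (intro sum.cong) auto

lemma psum_length: "psum \<theta> (length \<theta>) = sum_list \<theta>"
  by (simp add: psum_def part_def sum_list_sum_nth sum.atLeast1_atMost_eq atLeast0LessThan)

lemma sum_list_take: "m \<le> length \<theta> \<Longrightarrow> sum_list (take m \<theta>) = psum \<theta> m"
  using psum_length[of "take m \<theta>"] by (simp add: psum_take)

lemma Phi_take:
  assumes "m \<le> length \<theta>"
  shows "Phi (take m \<theta>) = {(i, j). \<exists>k\<in>{1..m}. 1 \<le> i \<and> i \<le> psum \<theta> k \<and> psum \<theta> k < j \<and> j \<le> psum \<theta> m}"
proof -
  have "length (take m \<theta>) = m" using assms by simp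
  then show ?thesis
    unfolding Phi_def sum_list_take[OF assms] by (simp add: psum_take cong: bex_cong_simp)
qed

text \<open>The cut \<open>k = Suc m\<close> admits no edge, since nothing lies beyond it, and the
  cut \<open>k = m\<close> yields all edges into the new block.\<close>

lemma Phi_take_Suc:
  assumes "Suc m \<le> length \<theta>"
  shows "Phi (take (Suc m) \<theta>)
    = Phi (take m \<theta>) \<union> {1..psum \<theta> m} \<times> {psum \<theta> m + 1..psum \<theta> (Suc m)}"
proof (intro equalityI subsetI)
  fix e assume "e \<in> Phi (take (Suc m) \<theta>)"
  then obtain i j k where e: "e = (i, j)" "1 \<le> k" "k \<le> Suc m" "1 \<le> i" "i \<le> psum \<theta> k"
      "psum \<theta> k < j" "j \<le> psum \<theta> (Suc m)"
    using assms by (auto simp: Phi_take)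
  then have "k \<noteq> Suc m" by auto
  then have k: "k \<le> m" using e by simp
  then have "i \<le> psum \<theta> m" using e psum_mono[OF k, of \<theta>] by simp
  then show "e \<in> Phi (take m \<theta>) \<union> {1..psum \<theta> m} \<times> {psum \<theta> m + 1..psum \<theta> (Suc m)}"
    using e k assms by (cases "j \<le> psum \<theta> m") (auto simp: Phi_take)
next
  fix e assume e: "e \<in> Phi (take m \<theta>) \<union> {1..psum \<theta> m} \<times> {psum \<theta> m + 1..psum \<theta> (Suc m)}"
  show "e \<in> Phi (take (Suc m) \<theta>)"
  proof (cases "e \<in> Phi (take m \<theta>)")
    case True
    then show ?thesis using assms psum_mono[of m "Suc m" \<theta>]
      by (fastforce simp: Phi_take)
  next
    case False
    then obtain i j where ij: "e = (i, j)" "1 \<le> i" "i \<le> psum \<theta> m" "psum \<theta> m < j" "j \<le> psum \<theta> (Suc m)"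
      using e by auto
    then have "1 \<le> m" by (cases m) auto
    then show ?thesis using ij assms by (auto simp: Phi_take intro!: bexI[of _ m])
  qed
qed

lemma Phi_take_subset:
  assumes "m \<le> length \<theta>"
  shows "Phi (take m \<theta>) \<subseteq> {(i, j). i \<in> {1..psum \<theta> m} \<and> j \<in> {1..psum \<theta> m} \<and> i < j}"
  using assms psum_mono[of _ m \<theta>] by (fastforce simp: Phi_take)

text \<open>The first cut with \<open>i\<close> on its left is the end of the block of
  \<open>i\<close>, so the successors of \<open>i\<close> are all vertices of later blocks.\<close>

lemma Phi_take_successors:
  assumes "m \<le> length \<theta>" "1 \<le> k" "k \<le> m" "psum \<theta> (k - 1) < i" "i \<le> psum \<theta> k"
  shows "{j. (i, j) \<in> Phi (take m \<theta>)} = {psum \<theta> k + 1..psum \<theta> m}"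
proof -
  have "k \<le> k'" if "i \<le> psum \<theta> k'" for k'
  proof (rule ccontr)
    assume "\<not> k \<le> k'"
    then have "psum \<theta> k' \<le> psum \<theta> (k - 1)" by (intro psum_mono) simp
    then show False using that assms(4) by simp
  qed
  then have "psum \<theta> k \<le> psum \<theta> k'" if "i \<le> psum \<theta> k'" for k'
    using that psum_mono by blast
  then show ?thesis
    using assms by (fastforce simp: Phi_take)
qed

lemma obtain_block:
  assumes "1 \<le> i" "i \<le> psum \<theta> m"
  obtains k where "1 \<le> k" "k \<le> m" "psum \<theta> (k - 1) < i" "i \<le> psum \<theta> k"
proof -
  define k where "k = (LEAST k. i \<le> psum \<theta> k)"
  have k: "i \<le> psum \<theta> k" unfolding k_def using assms(2) by (rule LeastI)
  have "k \<le> m" unfolding k_def using assms(2) by (rule Least_le)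
  moreover have "1 \<le> k" using k assms(1) by (cases k) auto
  moreover have "psum \<theta> (k - 1) < i"
    using not_less_Least[of "k - 1" "\<lambda>k. i \<le> psum \<theta> k"] \<open>1 \<le> k\<close> unfolding k_def[symmetric] by simp
  ultimately show ?thesis using that k by blast
qed

lemma psum_diff: "k \<le> m \<Longrightarrow> psum \<theta> m - psum \<theta> k = (\<Sum>j = k + 1..m. part \<theta> j)"
  using sum.ub_add_nat[of 1 k "part \<theta>" "m - k"] by (simp add: psum_def)

lemma sum_block_constant:
  assumes "\<And>k i. 1 \<le> k \<Longrightarrow> k \<le> m \<Longrightarrow> psum \<theta> (k - 1) < i \<Longrightarrow> i \<le> psum \<theta> k \<Longrightarrow> l i = c k"
  shows "(\<Sum>i = 1..psum \<theta> m. l i) = (\<Sum>k = 1..m. part \<theta> k * c k)"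
  using assms
proof (induction m)
  case 0
  then show ?case by simp
next
  case (Suc m)
  have "(\<Sum>i = 1..psum \<theta> (Suc m). l i)
      = (\<Sum>i = 1..psum \<theta> m. l i) + (\<Sum>i = psum \<theta> m + 1..psum \<theta> m + part \<theta> (Suc m). l i)"
    unfolding psum_Suc by (rule sum.ub_add_nat) simp
  also have "(\<Sum>i = psum \<theta> m + 1..psum \<theta> m + part \<theta> (Suc m). l i)
      = (\<Sum>i = psum \<theta> m + 1..psum \<theta> m + part \<theta> (Suc m). c (Suc m))"
    by (rule sum.cong) (auto intro!: Suc.prems simp: psum_Suc)
  finally show ?case using Suc by simp
qed

section \<open>Kostant partition functions as numbers of flows\<close>

lemma kostant_take_eq:
  assumes "m \<le> length \<theta>"
  shows "kostant (take m \<theta>) \<gamma> = card {f \<in> Phi (take m \<theta>) \<rightarrow>\<^sub>E UNIV. \<forall>i\<in>{1..psum \<theta> m}.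
     int (outflow (Phi (take m \<theta>)) f i) - int (inflow (Phi (take m \<theta>)) f i) = \<gamma> i}"
  using assms by (simp add: kostant_def outflow_def inflow_def sum_list_take)

text \<open>The last block consists of sinks. Membership in \<open>Y_plus\<close> makes
  \<open>\<gamma>\<close> vanish there except at \<open>n\<close>, which becomes the sink that
  absorbs the slack.\<close>

lemma kostant_eq_card_subflows:
  assumes comp: "is_composition \<eta> n" and len: "length \<eta> = Suc m" and \<gamma>: "\<gamma> \<in> Y_plus \<eta>"
  defines "E \<equiv> Phi (take m \<eta>)"
  shows "kostant \<eta> \<gamma> = card {f \<in> E \<rightarrow>\<^sub>E UNIV. \<forall>i\<in>{1..psum \<eta> m}.
           int (outflow E f i) \<le> \<gamma> i + int (inflow E f i)}"
proof -
  let ?N = "psum \<eta> m"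
  have n: "psum \<eta> (Suc m) = n" "sum_list \<eta> = n" using comp len psum_length[of \<eta>] by (auto simp: is_composition_def)
  have "0 < \<eta> ! m" using comp len by (auto simp: is_composition_def)
  then have Nn: "?N < n" using n(1) by (simp add: psum_Suc part_def)
  have nonneg: "0 \<le> \<gamma> i" if "1 \<le> i" "i < n" for i
    using \<gamma> n that by (auto simp: Y_plus_def)
  have total: "sum \<gamma> {1..n} = 0" using \<gamma> n by (simp add: Y_plus_def Y_def)
  \<comment> \<open>The choice \<open>{n}\<close> for \<open>\<Omega>\<close> in the last block: as
    the total is zero, the other entries of that block have sum at most zero, and they are
    non-negative.\<close>
  have "0 \<le> sum \<gamma> {1..?N} + sum \<gamma> {n}"
  proof -
    have "\<forall>\<Omega>\<subseteq>{psum \<eta> m + 1..psum \<eta> (m + 1)}. 0 \<le> sum \<gamma> {1..psum \<eta> m} + sum \<gamma> \<Omega>"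
      using \<gamma> len by (simp add: Y_plus_def Y_def)
    moreover have "{n} \<subseteq> {psum \<eta> m + 1..psum \<eta> (m + 1)}" using n(1) Nn by simp
    ultimately show ?thesis by blast
  qed
  moreover have split: "{1..n} = {1..?N} \<union> {?N + 1..n}" "{?N + 1..n} = insert n {?N + 1..<n}"
    using Nn by auto
  have "sum \<gamma> {1..n} = sum \<gamma> {1..?N} + (\<gamma> n + sum \<gamma> {?N + 1..<n})"
    unfolding split by (subst sum.union_disjoint) (use Nn in auto)
  ultimately have "sum \<gamma> {?N + 1..<n} \<le> 0" using total by simp
  moreover have "0 \<le> sum \<gamma> {?N + 1..<n}" by (intro sum_nonneg nonneg) auto
  ultimately have "sum \<gamma> {?N + 1..<n} = 0" by simp
  then have zero: "\<gamma> i = 0" if "i \<in> {?N + 1..n} - {n}" for i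
    using that nonneg sum_nonneg_eq_0_iff[of "{?N + 1..<n}" \<gamma>] by auto
  have Phi: "Phi (take (Suc m) \<eta>) = E \<union> {1..?N} \<times> {?N + 1..n}"
    using Phi_take_Suc[of m \<eta>] len by (simp add: E_def n)
  have "kostant \<eta> \<gamma> = kostant (take (Suc m) \<eta>) \<gamma>" using len by simp
  also have "\<dots> = card {F \<in> E \<union> {1..?N} \<times> {?N + 1..n} \<rightarrow>\<^sub>E UNIV. \<forall>i\<in>{1..?N} \<union> {?N + 1..n}.
     int (outflow (E \<union> {1..?N} \<times> {?N + 1..n}) F i) - int (inflow (E \<union> {1..?N} \<times> {?N + 1..n}) F i) = \<gamma> i}"
    using len unfolding split(1)[symmetric] Phi[symmetric] by (subst kostant_take_eq) (auto simp: n)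
  also have "\<dots> = card {f \<in> E \<rightarrow>\<^sub>E UNIV. \<forall>i\<in>{1..?N}. int (outflow E f i) \<le> \<gamma> i + int (inflow E f i)}"
  proof (rule card_flows_join_sinks[where s = n])
    show "E \<subseteq> {1..?N} \<times> {1..?N}" using Phi_take_subset[of m \<eta>] len by (auto simp: E_def)
    show "sum \<gamma> ({1..?N} \<union> {?N + 1..n}) = 0" using total split(1) by simp
  qed (use Nn zero in auto)
  finally show ?thesis .
qed

theorem theorem3p23:
  fixes \<eta> :: "nat list" and n p :: nat and l :: "nat \<Rightarrow> nat" and \<gamma> :: "nat \<Rightarrow> int"
  assumes "is_composition \<eta> n"
    and "length \<eta> = p"
    and "p \<ge> 3"
    and "\<And>k i. 1 \<le> k \<Longrightarrow> k \<le> p - 2 \<Longrightarrow> psum \<eta> (k - 1) < i \<Longrightarrow> i \<le> psum \<eta> k \<Longrightarrow>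
           l i = (\<Sum>j = k + 1..p - 1. part \<eta> j)"
    and "\<gamma> \<in> Y_plus \<eta>"
  shows "(\<Sum>i = 1..psum \<eta> (p - 2). l i) =
           (\<Sum>(i, j) | 1 \<le> i \<and> i < j \<and> j \<le> p - 1. part \<eta> i * part \<eta> j) \<and>
         kostant \<eta> \<gamma> =
           (\<Sum>\<beta> | \<beta> \<in> {1..psum \<eta> (p - 2)} \<rightarrow>\<^sub>E (UNIV :: nat set) \<and>
                  (\<Sum>i = 1..psum \<eta> (p - 2). \<beta> i) = (\<Sum>i = 1..psum \<eta> (p - 2). l i).
              kostant (take (p - 2) \<eta>) (\<lambda>i. int (\<beta> i) - int (l i)) *
              (\<Prod>j = 1..psum \<eta> (p - 2). nat (\<gamma> j + int (l j)) choose \<beta> j))"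
proof (rule conjI)
  define m where "m = p - 2"
  have m: "p - 1 = Suc m" "p - 2 = m" "length \<eta> = Suc (Suc m)"
    using assms(2,3) by (auto simp: m_def)
  note l = assms(4)[unfolded m]
  have "(\<Sum>i = 1..psum \<eta> m. l i) = (\<Sum>k = 1..m. part \<eta> k * (\<Sum>j = k + 1..Suc m. part \<eta> j))"
    by (rule sum_block_constant) (rule l)
  also have "\<dots> = (\<Sum>(i, j)\<in>Sigma {1..m} (\<lambda>k. {k + 1..Suc m}). part \<eta> i * part \<eta> j)"
    by (simp add: sum_distrib_left sum.Sigma del: sum.cl_ivl_Suc)
  also have "\<dots> = (\<Sum>(i, j) | 1 \<le> i \<and> i < j \<and> j \<le> Suc m. part \<eta> i * part \<eta> j)"
    by (rule sum.cong) auto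
  finally show "(\<Sum>i = 1..psum \<eta> (p - 2). l i) =
           (\<Sum>(i, j) | 1 \<le> i \<and> i < j \<and> j \<le> p - 1. part \<eta> i * part \<eta> j)"
    unfolding m .
  let ?V = "{1..psum \<eta> m}" and ?W = "{psum \<eta> m + 1..psum \<eta> (Suc m)}"
  define E E' where "E = Phi (take m \<eta>)" and "E' = Phi (take (Suc m) \<eta>)"
  define c where "c i = nat (\<gamma> i)" for i
  \<comment> \<open>\<open>M\<close> has to bound the total supply, for
    \<open>lidskii_count\<close>, and the sum of \<open>l\<close>, for the regrouping by
    \<open>\<beta>\<close>.\<close>
  define M where "M = sum c {1..psum \<eta> (Suc m)} + sum l ?V"
  have VW: "{1..psum \<eta> (Suc m)} = ?V \<union> ?W" using psum_mono[of m "Suc m" \<eta>] by auto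
  have E: "E \<subseteq> {(i, j). i \<in> ?V \<and> j \<in> ?V \<and> i < j}"
    unfolding E_def by (rule Phi_take_subset) (simp add: m)
  have E': "E' \<subseteq> {(i, j). i \<in> ?V \<union> ?W \<and> j \<in> ?V \<union> ?W \<and> i < j}"
    unfolding E'_def VW[symmetric] by (rule Phi_take_subset) (simp add: m)
  have join: "E' = E \<union> ?V \<times> ?W" unfolding E_def E'_def by (rule Phi_take_Suc) (simp add: m)
  have finE': "finite E'"
    by (rule finite_subset[of _ "(?V \<union> ?W) \<times> (?V \<union> ?W)"]) (use E' in auto)
  have n: "psum \<eta> (Suc m) < n"
  proof -
    have "0 < \<eta> ! Suc m" "n = psum \<eta> (Suc (Suc m))"
      using assms(1) m psum_length[of \<eta>] by (auto simp: is_composition_def)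
    then show ?thesis by (simp add: psum_Suc[of _ "Suc m"] part_def)
  qed
  \<comment> \<open>The first \<open>p - 1\<close> blocks end before \<open>n\<close>, the only
    vertex where \<open>\<gamma>\<close> may be negative.\<close>
  have c: "\<gamma> i = int (c i)" if "i \<in> ?V \<union> ?W" for i
  proof -
    have "sum_list \<eta> = n" using assms(1) by (simp add: is_composition_def)
    moreover have "1 \<le> i" "i \<le> n - 1" using that n unfolding VW[symmetric] by auto
    ultimately have "0 \<le> \<gamma> i" using assms(5) by (simp add: Y_plus_def)
    then show ?thesis by (simp add: c_def)
  qed
  \<comment> \<open>This identifies \<open>l\<close>: its value at \<open>i\<close> is the number of
    vertices in the later blocks up to block \<open>p - 1\<close>.\<close>
  have outdeg_V: "outdeg E' i = l i" if i: "i \<in> ?V" for i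
  proof -
    obtain k where k: "1 \<le> k" "k \<le> m" "psum \<eta> (k - 1) < i" "i \<le> psum \<eta> k"
      by (rule obtain_block[of i \<eta> m]) (use i in simp_all)
    have "outdeg E' i = psum \<eta> (Suc m) - psum \<eta> k"
      unfolding E'_def using k m by (subst Phi_take_successors[of "Suc m" \<eta> k]) auto
    also have "\<dots> = l i" using k l by (simp add: psum_diff del: sum.cl_ivl_Suc)
    finally show ?thesis .
  qed
  have outdeg_W: "outdeg E' i = 0" if "i \<in> ?W" for i
  proof -
    have "{j. (i, j) \<in> E'} = {}" using that E unfolding join by auto
    then show ?thesis by simp
  qed
  have "kostant \<eta> \<gamma> = card {f \<in> E' \<rightarrow>\<^sub>E UNIV. \<forall>i\<in>?V \<union> ?W. int (outflow E' f i) \<le> \<gamma> i + int (inflow E' f i)}"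
    using kostant_eq_card_subflows[OF assms(1) m(3) assms(5)] unfolding E'_def VW .
  \<comment> \<open>No value exceeds the total supply, so the bound \<open>M\<close> loses no family
    and the count can be written as a finite sum of indicators.\<close>
  also have "{f \<in> E' \<rightarrow>\<^sub>E UNIV. \<forall>i\<in>?V \<union> ?W. int (outflow E' f i) \<le> \<gamma> i + int (inflow E' f i)}
      = {f \<in> E' \<rightarrow>\<^sub>E {..M}. \<forall>i\<in>?V \<union> ?W. outflow E' f i \<le> c i + inflow E' f i}"
  proof -
    have "f e \<le> M" if "\<forall>i\<in>?V \<union> ?W. outflow E' f i \<le> c i + inflow E' f i" "e \<in> E'" for f e
      using flow_le_sum_supply[OF _ E', of f c e] that unfolding M_def VW by fastforce
    moreover have "int (outflow E' f i) \<le> \<gamma> i + int (inflow E' f i) \<longleftrightarrow> outflow E' f i \<le> c i + inflow E' f i"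
      if "i \<in> ?V \<union> ?W" for f i
      unfolding c[OF that] by linarith
    ultimately show ?thesis
      by (auto simp: PiE_def Pi_def simp del: Un_iff)
  qed
  also have "card \<dots> = (\<Sum>f\<in>E' \<rightarrow>\<^sub>E {..M}. \<Prod>i\<in>?V \<union> ?W. of_bool (outflow E' f i \<le> c i + inflow E' f i))"
  proof -
    have "(\<Prod>i\<in>S. of_bool (P i)) = (of_bool (\<forall>i\<in>S. P i) :: nat)" if "finite S" for S :: "nat set" and P
      using that by (induction S) auto
    moreover have "finite (E' \<rightarrow>\<^sub>E {..M})" using finE' by (intro finite_PiE) auto
    ultimately show ?thesis by (simp add: Int_def)
  qed
  also have "\<dots> = (\<Sum>g\<in>E' \<rightarrow>\<^sub>E {..M}. \<Prod>i\<in>?V \<union> ?W.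
         choose_diff (c i + outdeg E' i) (outdeg E' i + outflow E' g i) (inflow E' g i))"
    by (rule lidskii_count[OF _ E']) (simp, simp only: M_def VW le_add1)
  \<comment> \<open>Block \<open>p - 1\<close> drops out as a block of sinks of \<open>E'\<close>.
    The out-degrees remain those in \<open>E'\<close>, which is why \<open>l\<close> reaches up to
    part \<open>p - 1\<close> while the flows live on \<open>p - 2\<close> blocks.\<close>
  also have "\<dots> = (\<Sum>g\<in>E \<rightarrow>\<^sub>E {..M}. \<Prod>i\<in>?V.
         choose_diff (c i + outdeg E' i) (outdeg E' i + outflow E g i) (inflow E g i))"
    unfolding join
    by (rule sum_choose_diff_join_sinks) (use E outdeg_W in \<open>auto simp: join\<close>)
  also have "\<dots> = (\<Sum>g\<in>E \<rightarrow>\<^sub>E {..M}. \<Prod>i\<in>?V. choose_diff (c i + l i) (l i + outflow E g i) (inflow E g i))"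
    by (intro sum.cong prod.cong refl) (simp only: outdeg_V)
  also have "\<dots> = (\<Sum>\<beta> | \<beta> \<in> ?V \<rightarrow>\<^sub>E UNIV \<and> sum \<beta> ?V = sum l ?V.
            card {g \<in> E \<rightarrow>\<^sub>E UNIV. \<forall>i\<in>?V. int (outflow E g i) - int (inflow E g i) = int (\<beta> i) - int (l i)} *
            (\<Prod>i\<in>?V. c i + l i choose \<beta> i))"
    by (rule sum_card_flows_mult_prod_choose[symmetric, OF _ E]) (simp_all add: M_def)
  also have "\<dots> = (\<Sum>\<beta> | \<beta> \<in> ?V \<rightarrow>\<^sub>E UNIV \<and> sum \<beta> ?V = sum l ?V.
              kostant (take m \<eta>) (\<lambda>i. int (\<beta> i) - int (l i)) *
              (\<Prod>j = 1..psum \<eta> m. nat (\<gamma> j + int (l j)) choose \<beta> j))"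
  proof -
    have "nat (\<gamma> j + int (l j)) = c j + l j" if "j \<in> ?V" for j
      using c[of j] that by (simp add: nat_add_distrib)
    then show ?thesis
      using m by (simp add: kostant_take_eq E_def)
  qed
  finally show "kostant \<eta> \<gamma> =
           (\<Sum>\<beta> | \<beta> \<in> {1..psum \<eta> (p - 2)} \<rightarrow>\<^sub>E (UNIV :: nat set) \<and>
                  (\<Sum>i = 1..psum \<eta> (p - 2). \<beta> i) = (\<Sum>i = 1..psum \<eta> (p - 2). l i).
              kostant (take (p - 2) \<eta>) (\<lambda>i. int (\<beta> i) - int (l i)) *
              (\<Prod>j = 1..psum \<eta> (p - 2). nat (\<gamma> j + int (l j)) choose \<beta> j))"
    unfolding m .
qed

end
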